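(* An ultrametric space $\mathbf{M}=(M,d)$ is spec-homogeneous if and only if for every pair of similar balls $B,B'$ of $\mathbf{M}$, the metric subspaces induced by $\mathbf{M}$ on $B$ and on $B'$ are isometric.
   Context: A metric space $(M,d)$ is ultrametric if $d(x,z)\le\max\{d(x,y),d(y,z)\}$ for all $x,y,z$. For $a\in M$ and a real $r\ge 0$, the open ball is $B(a,r)=\{x\in M: d(a,x)<r\}$ and the closed ball is $\hat B(a,r)=\{x\in M: d(a,x)\le r\}$; a ball is an open or a closed ball. The diameter of $A\subseteq M$ is $\delta(A)=\sup\{d(x,y):x,y\in A\}$. The spectrum of $a\in M$ is $\mathrm{Spec}(\mathbf{M},a)=\{d(a,x):x\in M\}$. A local isometry of $\mathbf{M}$ is an isometry from a metric subspace of $\mathbf{M}$ onto another one. A local spec-isometry is a local isometry $f$ such that $\mathrm{Spec}(\mathbf{M},x)=\mathrm{Spec}(\mathbf{M},f(x))$ for every $x$ in the domain of $f$. The space $\mathbf{M}$ is spec-homogeneous if every local spec-isometry of $\mathbf{M}$ with finite domain extends to a surjective isometry of $\mathbf{M}$ onto itself. Two balls have the same kind if they have the same diameter and this diameter is attained (as a distance between two points of the ball) in both or in none. Two balls $B,B'$ of $\mathbf{M}$ are similar if they have the same kind and there are $x\in B$, $x'\in B'$ with $\mathrm{Spec}(\mathbf{M},x)=\mathrm{Spec}(\mathbf{M},x')$. *)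

theory Defs
  imports "HOL-Analysis.Analysis"
begin

locale Ultrametric_space = Metric_space +
  assumes ultrametric: "\<And>x y z. \<lbrakk>x \<in> M; y \<in> M; z \<in> M\<rbrakk> \<Longrightarrow> d x z \<le> max (d x y) (d y z)"

context Metric_space
begin

(* Radius 0 is allowed, so the empty set is an (open) ball whenever M is nonempty. *)
definition is_ball :: "'a set \<Rightarrow> bool" where
  "is_ball B \<longleftrightarrow> (\<exists>a\<in>M. \<exists>r\<ge>0. B = mball a r \<or> B = mcball a r)"

(* As for the type-class constant diameter, the empty set gets diameter 0; on unbounded
   sets the value is unspecified, but the notion is only applied to balls. *)
definition mdiameter :: "'a set \<Rightarrow> real" where
  "mdiameter A = (if A = {} then 0 else (SUP (x, y) \<in> A \<times> A. d x y))"

definition diameter_attained :: "'a set \<Rightarrow> bool" where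
  "diameter_attained A \<longleftrightarrow> (\<exists>x\<in>A. \<exists>y\<in>A. d x y = mdiameter A)"

definition spectrum :: "'a \<Rightarrow> real set" where
  "spectrum a = {d a x | x. x \<in> M}"

definition isometry :: "'a set \<Rightarrow> 'a set \<Rightarrow> ('a \<Rightarrow> 'a) \<Rightarrow> bool" where
  "isometry A B f \<longleftrightarrow> f ` A = B \<and> (\<forall>x\<in>A. \<forall>y\<in>A. d (f x) (f y) = d x y)"

definition isometric :: "'a set \<Rightarrow> 'a set \<Rightarrow> bool" where
  "isometric A B \<longleftrightarrow> (\<exists>f. isometry A B f)"

(* A partial map of M is given by its domain A and a total function f, of which only
   the values on A matter. *)
definition local_isometry :: "'a set \<Rightarrow> ('a \<Rightarrow> 'a) \<Rightarrow> bool" where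
  "local_isometry A f \<longleftrightarrow> A \<subseteq> M \<and> (\<exists>B\<subseteq>M. isometry A B f)"

definition local_spec_isometry :: "'a set \<Rightarrow> ('a \<Rightarrow> 'a) \<Rightarrow> bool" where
  "local_spec_isometry A f \<longleftrightarrow>
     local_isometry A f \<and> (\<forall>x\<in>A. spectrum x = spectrum (f x))"

definition spec_homogeneous :: bool where
  "spec_homogeneous \<longleftrightarrow>
     (\<forall>A f. finite A \<and> local_spec_isometry A f \<longrightarrow>
        (\<exists>g. isometry M M g \<and> (\<forall>x\<in>A. g x = f x)))"

definition same_kind :: "'a set \<Rightarrow> 'a set \<Rightarrow> bool" where
  "same_kind B B' \<longleftrightarrow>
     mdiameter B = mdiameter B' \<and> (diameter_attained B \<longleftrightarrow> diameter_attained B')"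

definition similar :: "'a set \<Rightarrow> 'a set \<Rightarrow> bool" where
  "similar B B' \<longleftrightarrow> same_kind B B' \<and> (\<exists>x\<in>B. \<exists>x'\<in>B'. spectrum x = spectrum x')"

end

end

(* Points with the same spectrum have balls of the same kind around them. For spectrally
   equal points b, b' and a radius r, an isometry between the closed balls may send b away from
   b'; exchanging two open balls of radius r corrects this, so the spheres of radius r around b
   and b' are isometric as well. Gluing isometries of concentric spheres gives a global isometry
   moving b to b'. A finite local spec-isometry is then extended one point at a time: up to
   composition it fixes all points but b, and the remaining points lie outside the open balls of
   radius d b b' around b and b', so exchanging these two balls does not disturb them. *)

theory Submission
  imports Defs
begin

section \<open>Isometries between subsets of a metric space\<close>

context Metric_space
begin

lemma isometry_compose:
  "isometry A B f \<Longrightarrow> isometry B C g \<Longrightarrow> isometry A C (g \<circ> f)"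
  unfolding isometry_def by (auto simp: image_comp [symmetric])

lemma isometry_inj_on:
  assumes "isometry A B f" "A \<subseteq> M" "B \<subseteq> M"
  shows "inj_on f A"
proof (rule inj_onI)
  fix x y assume xy: "x \<in> A" "y \<in> A" "f x = f y"
  then have "f x \<in> M" using assms by (auto simp: isometry_def)
  have "d x y = d (f x) (f y)" using xy(1,2) assms(1) by (simp add: isometry_def)
  also have "\<dots> = 0" using xy(3) \<open>f x \<in> M\<close> by simp
  finally have "d x y = 0" .
  then show "x = y" using xy(1,2) assms(2) by (metis subsetD zero)
qed

lemma isometry_inv_into:
  assumes "isometry A B f" "A \<subseteq> M" "B \<subseteq> M"
  shows "isometry B A (inv_into A f)"
proof -
  have "inj_on f A" using isometry_inj_on assms by blast
  then show ?thesis using assms(1)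
    unfolding isometry_def by (auto simp: inv_into_image_cancel)
qed

lemma isometry_subset:
  "isometry A B f \<Longrightarrow> A' \<subseteq> A \<Longrightarrow> isometry A' (f ` A') f"
  unfolding isometry_def by blast

lemma isometry_spectrum:
  assumes "isometry M M g" "x \<in> M"
  shows "spectrum (g x) = spectrum x"
proof -
  have "spectrum (g x) = d (g x) ` g ` M"
    using assms(1) unfolding isometry_def spectrum_def by blast
  also have "\<dots> = d x ` M"
    using assms unfolding image_image isometry_def by (intro image_cong) auto
  finally show ?thesis unfolding spectrum_def by blast
qed

text \<open>Being an isometry onto \<open>B\<close>, \<open>f\<close> carries a region cut out by
  distances from \<open>x\<close> onto the region of \<open>B\<close> cut out in the same way from
  \<open>f x\<close>. Open and closed balls are the instances used.\<close>

lemma isometry_image_Collect: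
  assumes "isometry A B f" "x \<in> A"
  shows "f ` {y \<in> A. P (d x y)} = {z \<in> B. P (d (f x) z)}"
proof -
  have "d (f x) (f y) = d x y" if "y \<in> A" for y
    using assms that by (simp add: isometry_def)
  moreover have "B = f ` A" using assms by (simp add: isometry_def)
  ultimately show ?thesis by auto
qed

text \<open>\<open>A\<close> and \<open>B\<close> are kept general because this is applied both to
  isometries between closed balls and to isometries of the whole space.\<close>

lemma isometry_image_mball:
  assumes "isometry A B f" "x \<in> A" "A \<subseteq> M" "B \<subseteq> M" "mball x r \<subseteq> A" "mball (f x) r \<subseteq> B"
  shows "f ` mball x r = mball (f x) r"
proof -
  have "f x \<in> M" "x \<in> M" using assms(1-4) unfolding isometry_def by blast+
  then have "mball x r = {y \<in> A. d x y < r}" "mball (f x) r = {y \<in> B. d (f x) y < r}"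
    using assms(3-6) unfolding mball_def by blast+
  then show ?thesis using isometry_image_Collect [OF assms(1,2), of "\<lambda>t. t < r"] by simp
qed

lemma isometry_image_mcball:
  assumes "isometry M M f" "x \<in> M"
  shows "f ` mcball x r = mcball (f x) r"
proof -
  have "f x \<in> M" using assms unfolding isometry_def by blast
  then show ?thesis
    using assms(2) isometry_image_Collect [OF assms, of "\<lambda>t. t \<le> r"] by (simp add: mcball_def)
qed

end

section \<open>Balls, diameters and spectra in an ultrametric space\<close>

context Ultrametric_space
begin

text \<open>The isosceles property: the two longest sides of an ultrametric triangle are
  equal.\<close>

lemma dist_eq_of_less:
  assumes "x \<in> M" "y \<in> M" "z \<in> M" "d x y < d y z"
  shows "d x z = d y z"
  using ultrametric [of y x z] ultrametric [of x y z] assms commute [of x y] by auto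

lemma mball_recenter:
  assumes "x \<in> mball a r"
  shows "mball a r = mball x r"
proof -
  have "d a y < r \<longleftrightarrow> d x y < r" if "y \<in> M" for y
    using assms that ultrametric [of a x y] ultrametric [of x a y] commute [of a x] by auto
  then show ?thesis using assms by auto
qed

lemma mcball_recenter:
  assumes "x \<in> mcball a r"
  shows "mcball a r = mcball x r"
proof -
  have "d a y \<le> r \<longleftrightarrow> d x y \<le> r" if "y \<in> M" for y
    using assms that ultrametric [of a x y] ultrametric [of x a y] commute [of a x] by auto
  then show ?thesis using assms by auto
qed

text \<open>Since \<open>d u v\<close> is at most the larger of \<open>d x u\<close> and
  \<open>d x v\<close>, the distances from the single point \<open>x\<close> dominate all distances
  inside \<open>B\<close>. The set \<open>D\<close> is a separate variable so that it can be
  instantiated with a truncated spectrum.\<close>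

lemma mdiameter_spectrum:
  assumes "x \<in> B" "B \<subseteq> M" and D: "d x ` B = D" and "bdd_above D"
  shows "mdiameter B = Sup D"
    and "diameter_attained B \<longleftrightarrow> Sup D \<in> D"
proof -
  have ne: "D \<noteq> {}" using assms by auto
  have le: "\<exists>t\<in>D. d u v \<le> t" if "u \<in> B" "v \<in> B" for u v
  proof -
    have "d u v \<le> max (d x u) (d x v)"
      using ultrametric [of u x v] that assms commute [of u x] by auto
    moreover have "d x u \<in> D" "d x v \<in> D" using that D by auto
    ultimately show ?thesis by (auto simp: le_max_iff_disj)
  qed
  have le': "d u v \<le> Sup D" if "u \<in> B" "v \<in> B" for u v
    using le [OF that] assms(4) cSup_upper order_trans by blast
  show diam: "mdiameter B = Sup D"
  proof -
    have "(SUP (u, v) \<in> B \<times> B. d u v) = Sup D"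
    proof (rule antisym)
      show "(SUP (u, v) \<in> B \<times> B. d u v) \<le> Sup D"
        using assms(1) le' by (intro cSUP_least) auto
      have "bdd_above ((\<lambda>(u, v). d u v) ` (B \<times> B))"
        using le' by (intro bdd_aboveI2 [of _ _ "Sup D"]) auto
      then show "Sup D \<le> (SUP (u, v) \<in> B \<times> B. d u v)"
        using assms(1) D ne
        by (intro cSup_mono) (auto intro!: bexI [of _ "(x, _)"])
    qed
    then show ?thesis using assms(1) by (auto simp: mdiameter_def)
  qed
  show "diameter_attained B \<longleftrightarrow> Sup D \<in> D"
  proof
    assume "diameter_attained B"
    then obtain u v where uv: "u \<in> B" "v \<in> B" "d u v = Sup D"
      by (auto simp: diameter_attained_def diam)
    then obtain t where "t \<in> D" "Sup D \<le> t" using le by metis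
    moreover have "t \<le> Sup D" using \<open>t \<in> D\<close> assms(4) by (rule cSup_upper)
    ultimately show "Sup D \<in> D" by simp
  next
    assume "Sup D \<in> D"
    then have "Sup D \<in> d x ` B" by (simp only: D)
    then obtain y where "y \<in> B" "Sup D = d x y" by blast
    then show "diameter_attained B"
      unfolding diameter_attained_def diam using assms(1) by metis
  qed
qed

text \<open>The distances from \<open>x\<close> within its open ball are the elements of its
  spectrum below \<open>r\<close>, so spectrum and radius alone fix the kind. Positivity of
  \<open>r\<close> puts the centers into the balls, where they witness the common spectrum.\<close>

lemma similar_mball:
  assumes "x \<in> M" "x' \<in> M" "spectrum x = spectrum x'" "0 < r"
  shows "similar (mball x r) (mball x' r)"
proof -
  let ?D = "\<lambda>x. {t \<in> spectrum x. t < r}"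
  have img: "d y ` mball y r = ?D y" if "y \<in> M" for y
    using that by (auto simp: spectrum_def)
  have bdd: "bdd_above (?D y)" for y by (auto intro: bdd_aboveI [of _ r])
  have "x \<in> mball x r" "x' \<in> mball x' r" using assms by auto
  moreover from this have "\<exists>y\<in>mball x r. \<exists>y'\<in>mball x' r. spectrum y = spectrum y'"
    using assms(3) by blast
  ultimately show ?thesis
    using mdiameter_spectrum [of x "mball x r", OF _ mball_subset_mspace img bdd]
      mdiameter_spectrum [of x' "mball x' r", OF _ mball_subset_mspace img bdd] assms
    by (simp add: similar_def same_kind_def del: in_mball)
qed

lemma similar_mcball:
  assumes "x \<in> M" "x' \<in> M" "spectrum x = spectrum x'" "0 < r"
  shows "similar (mcball x r) (mcball x' r)"
proof -
  let ?D = "\<lambda>x. {t \<in> spectrum x. t \<le> r}"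
  have img: "d y ` mcball y r = ?D y" if "y \<in> M" for y
    using that by (auto simp: spectrum_def)
  have bdd: "bdd_above (?D y)" for y by (auto intro: bdd_aboveI [of _ r])
  have "x \<in> mcball x r" "x' \<in> mcball x' r" using assms by auto
  moreover from this have "\<exists>y\<in>mcball x r. \<exists>y'\<in>mcball x' r. spectrum y = spectrum y'"
    using assms(3) by blast
  ultimately show ?thesis
    using mdiameter_spectrum [of x "mcball x r", OF _ mcball_subset_mspace img bdd]
      mdiameter_spectrum [of x' "mcball x' r", OF _ mcball_subset_mspace img bdd] assms
    by (simp add: similar_def same_kind_def del: in_mcball)
qed

text \<open>A ball may arise from several radii; its kind gives a canonical description around any
  of its points, closed if the diameter is attained and open otherwise.\<close>

lemma ball_eq_of_kind:
  assumes "is_ball B" "x \<in> B"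
  shows "B = {y \<in> M. d x y < mdiameter B \<or> diameter_attained B \<and> d x y = mdiameter B}"
proof -
  obtain r where r: "B = mball x r \<or> B = mcball x r"
    using assms mball_recenter mcball_recenter unfolding is_ball_def by blast
  have BM: "B \<subseteq> M" and xM: "x \<in> M" using r assms(2) by auto
  have bdd: "bdd_above (d x ` B)" using r by (auto intro!: bdd_aboveI [of _ r])
  note diam = mdiameter_spectrum [OF assms(2) BM refl bdd]
  have le: "d x y \<le> mdiameter B" if "y \<in> B" for y
    using that bdd by (simp add: diam cSup_upper)
  have attained: "diameter_attained B" if "y \<in> B" "d x y = mdiameter B" for y
    using that assms(2) by (auto simp: diameter_attained_def)
  have closer: "y \<in> B" if "y \<in> M" "z \<in> B" "d x y \<le> d x z" for y z
    using that r xM by auto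
  \<comment> \<open>By \<open>closer\<close>, a point of \<open>B\<close> at least as far from
    \<open>x\<close> as \<open>y\<close> is enough to put \<open>y\<close> into \<open>B\<close>. It
    realizes the diameter if that is attained, and otherwise comes from the supremum.\<close>
  have "\<exists>z\<in>B. d x y \<le> d x z"
    if "d x y < mdiameter B \<or> diameter_attained B \<and> d x y = mdiameter B" for y
  proof (cases "diameter_attained B")
    case True
    then have "mdiameter B \<in> d x ` B" using diam by simp
    then obtain z where "z \<in> B" "mdiameter B = d x z" by blast
    then show ?thesis using that by (metis order_refl less_imp_le)
  next
    case False
    then have "d x y < Sup (d x ` B)" using that diam(1) by simp
    moreover have "d x ` B \<noteq> {}" using assms(2) by blast
    ultimately have "\<exists>t\<in>d x ` B. d x y < t" using less_cSup_iff [OF _ bdd] by blast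
    then show ?thesis by (blast intro: less_imp_le)
  qed
  then show ?thesis using closer BM le attained by (auto simp: less_le subset_iff)
qed

section \<open>From spec-homogeneity to isometric similar balls\<close>

lemma isometric_if_spec_homogeneous:
  assumes "spec_homogeneous" "is_ball B" "is_ball B'" "similar B B'"
  shows "isometric B B'"
proof -
  obtain x x' where x: "x \<in> B" "x' \<in> B'" "spectrum x = spectrum x'"
    and kind: "mdiameter B = mdiameter B'" "diameter_attained B \<longleftrightarrow> diameter_attained B'"
    using assms by (auto simp: similar_def same_kind_def)
  note B = ball_eq_of_kind [OF assms(2) x(1)] and B' = ball_eq_of_kind [OF assms(3) x(2)]
  have M: "x \<in> M" "x' \<in> M" using B B' x by blast+
  \<comment> \<open>Spec-homogeneity is applied to a one-point map. Its extension carries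
    \<open>B\<close> onto \<open>B'\<close> because the canonical descriptions of the two balls from
    \<open>x\<close> and \<open>x'\<close> agree.\<close>
  have "local_spec_isometry {x} (\<lambda>_. x')"
    using M x(3) by (auto simp: local_spec_isometry_def local_isometry_def isometry_def)
  then obtain g where g: "isometry M M g" "g x = x'"
    using assms(1) unfolding spec_homogeneous_def by (metis finite.emptyI finite.insertI singletonI)
  have dg: "d x' (g y) = d x y" if "y \<in> M" for y
    using g M that by (auto simp: isometry_def)
  have gM: "g ` M = M" using g by (simp add: isometry_def)
  have "g ` B = B'"
  proof
    show "g ` B \<subseteq> B'"
    proof
      fix z assume "z \<in> g ` B"
      then obtain y where "y \<in> B" "z = g y" by auto
      then have "y \<in> M" "z \<in> M" using B gM by blast+
      then show "z \<in> B'"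
        using \<open>y \<in> B\<close> \<open>z = g y\<close> dg [OF \<open>y \<in> M\<close>] kind by (subst B', subst (asm) B) auto
    qed
    show "B' \<subseteq> g ` B"
    proof
      fix z assume z: "z \<in> B'"
      then have "z \<in> M" using B' by blast
      then obtain y where y: "y \<in> M" "z = g y" using gM by auto
      then have "y \<in> B" using z dg [OF y(1)] kind by (subst B, subst (asm) B') auto
      then show "z \<in> g ` B" using y by auto
    qed
  qed
  moreover have "B \<subseteq> M" using B by blast
  ultimately show ?thesis
    using g isometry_subset [of M M g B] by (auto simp: isometric_def)
qed

section \<open>Exchanging two open balls\<close>

text \<open>Swap the balls by \<phi> and its inverse and fix everything else. Points of different
  balls are at distance exactly \<open>r\<close>, before and after the swap. A point outside both is
  at distance at least \<open>r\<close> from each point of the balls, and the swap moves these by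
  exactly \<open>r\<close>, so that distance does not change either.\<close>

lemma isometry_exchange:
  assumes "c \<in> M" "c' \<in> M" "d c c' = r" and \<phi>: "isometry (mball c r) (mball c' r) \<phi>"
  obtains g where "isometry M M g" "\<And>x. x \<in> mball c r \<Longrightarrow> g x = \<phi> x"
    "\<And>x. x \<in> M \<Longrightarrow> x \<notin> mball c r \<Longrightarrow> x \<notin> mball c' r \<Longrightarrow> g x = x"
proof -
  let ?P = "mball c r" and ?P' = "mball c' r"
  define \<psi> where "\<psi> = inv_into ?P \<phi>"
  define g where "g x = (if x \<in> ?P then \<phi> x else if x \<in> ?P' then \<psi> x else x)" for x
  have \<psi>: "isometry ?P' ?P \<psi>"
    unfolding \<psi>_def by (rule isometry_inv_into [OF \<phi>]) auto
  have inj: "inj_on \<phi> ?P" using \<phi> by (rule isometry_inj_on) auto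
  have across: "d x y = r" if "x \<in> ?P" "y \<in> ?P'" for x y
  proof -
    have "d x c' = r" using dist_eq_of_less [of x c c'] that assms commute [of x c] by auto
    then show ?thesis
      using dist_eq_of_less [of y c' x] that commute [of y c'] commute [of x c'] commute [of x y]
      by auto
  qed
  \<comment> \<open>A common point would force \<open>r = 0\<close>, but then the open balls are
    empty.\<close>
  have disj: "x \<notin> ?P'" if "x \<in> ?P" for x
    using across [of x x] that nonneg [of c x] by auto
  have maps: "\<phi> x \<in> ?P'" if "x \<in> ?P" for x using \<phi> that unfolding isometry_def by blast
  have maps': "\<psi> x \<in> ?P" if "x \<in> ?P'" for x using \<psi> that unfolding isometry_def by blast
  have inv: "\<psi> (\<phi> x) = x" if "x \<in> ?P" for x using inj that by (simp add: \<psi>_def)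
  have inv': "\<phi> (\<psi> x) = x" if "x \<in> ?P'" for x
    using \<phi> that unfolding \<psi>_def isometry_def by (metis f_inv_into_f)
  have gP: "g x = \<phi> x" if "x \<in> ?P" for x using that by (simp add: g_def)
  have gP': "g x = \<psi> x" if "x \<in> ?P'" for x using that disj by (metis g_def)
  have gO: "g x = x" if "x \<notin> ?P" "x \<notin> ?P'" for x using that by (simp only: g_def if_False)
  have gM: "g x \<in> M" if "x \<in> M" for x
    using gP gP' gO maps maps' that mball_subset_mspace by (metis subsetD)
  have gg: "g (g x) = x" for x
    using gP gP' gO maps maps' inv inv' by metis
  have move: "d x (g x) = r" if "x \<in> ?P \<union> ?P'" for x
    using that across commute gP gP' maps maps' by (metis UnE)
  \<comment> \<open>By recentring, a point closer than \<open>r\<close> to \<open>y\<close> would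
    lie in the same ball as \<open>y\<close>.\<close>
  have far: "r \<le> d x y" if "x \<in> M" "x \<notin> ?P" "x \<notin> ?P'" "y \<in> ?P \<union> ?P'" for x y
    using that mball_recenter commute by (metis UnE in_mball linorder_not_less)
  have dist_out: "d x (g y) \<le> d x y"
    if "x \<in> M" "x \<notin> ?P" "x \<notin> ?P'" "y \<in> ?P \<union> ?P'" for x y
  proof -
    have "y \<in> M" using that by auto
    then show ?thesis
      using ultrametric [of x y "g y"] gM that far [OF that] move [OF that(4)] by auto
  qed
  \<comment> \<open>One inequality suffices: \<open>g\<close> is an involution, so applying it to
    \<open>g x\<close> and \<open>g y\<close> yields the converse.\<close>
  have le: "d (g x) (g y) \<le> d x y" if xy: "x \<in> M" "y \<in> M" for x y
  proof -
    consider "x \<in> ?P" "y \<in> ?P" | "x \<in> ?P'" "y \<in> ?P'" | "x \<in> ?P" "y \<in> ?P'" | "x \<in> ?P'" "y \<in> ?P"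
      | "x \<notin> ?P" "x \<notin> ?P'" "y \<in> ?P \<union> ?P'" | "y \<notin> ?P" "y \<notin> ?P'" "x \<in> ?P \<union> ?P'"
      | "x \<notin> ?P" "x \<notin> ?P'" "y \<notin> ?P" "y \<notin> ?P'"
      by blast
    then show ?thesis
    proof cases
      case 1 then show ?thesis using \<phi> gP by (simp add: isometry_def del: in_mball)
    next
      case 2 then show ?thesis using \<psi> gP' by (simp add: isometry_def del: in_mball)
    next
      case 3 then show ?thesis
        using across gP gP' maps maps' commute by (metis order_refl)
    next
      case 4 then show ?thesis
        using across gP gP' maps maps' commute by (metis order_refl)
    next
      case 5 then show ?thesis using dist_out xy gO by metis
    next
      case 6 then show ?thesis using dist_out xy gO commute by metis
    next
      case 7 then show ?thesis using gO by simp
    qed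
  qed
  have "d (g x) (g y) = d x y" if "x \<in> M" "y \<in> M" for x y
    using le [OF that] le [OF gM gM, OF that] by (simp add: gg)
  moreover have "g ` M = M" using gM gg by (metis (no_types) image_subset_iff subset_antisym subset_eq image_eqI)
  ultimately have "isometry M M g" by (simp add: isometry_def)
  then show thesis using that gP gO by blast
qed

section \<open>Isometries of spheres and their gluing\<close>

text \<open>A sphere of positive radius is the closed ball minus the open ball. So it is enough that
  some isometry of the closed balls carries one open ball onto the other; injectivity then handles
  the difference.\<close>

lemma sphere_isometry:
  assumes hyp: "\<And>B B'. is_ball B \<Longrightarrow> is_ball B' \<Longrightarrow> similar B B' \<Longrightarrow> isometric B B'"
    and b: "b \<in> M" "b' \<in> M" "spectrum b = spectrum b'"
  shows "isometric {x \<in> M. d b x = r} {x \<in> M. d b' x = r}"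
proof (cases "0 < r")
  case False
  \<comment> \<open>Spheres of nonpositive radius degenerate to the center or the empty set.\<close>
  have "{x \<in> M. d a x = r} = (if r = 0 then {a} else {})" if "a \<in> M" for a
    using that False nonneg [of a] by (auto simp: order.order_iff_strict)
  then show ?thesis using b by (auto simp: isometric_def isometry_def)
next
  case r: True
  have ball: "is_ball (mball a r)" "is_ball (mcball a r)" if "a \<in> M" for a
    using that less_imp_le [OF r] unfolding is_ball_def by blast+
  have "isometric (mcball b r) (mcball b' r)" "isometric (mball b r) (mball b' r)"
    using ball [of b] ball [of b'] similar_mball [OF b r] similar_mcball [OF b r] b
    by (blast intro: hyp)+
  then obtain \<phi> \<theta> where \<phi>: "isometry (mcball b r) (mcball b' r) \<phi>"
    and \<theta>: "isometry (mball b r) (mball b' r) \<theta>"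
    by (auto simp: isometric_def)
  define c where "c = \<phi> b"
  have bc: "b \<in> mcball b r" using b r by auto
  have c: "c \<in> mcball b' r" using \<phi> bc by (auto simp: isometry_def c_def simp del: in_mcball)
  have cM: "c \<in> M" using c by auto
  have c_eq: "mcball b' r = mcball c r" using c by (rule mcball_recenter)
  have img: "\<phi> ` mball b r = mball c r"
    unfolding c_def
    using isometry_image_mball [OF \<phi> bc mcball_subset_mspace mcball_subset_mspace
      mball_subset_mcball] c_eq mball_subset_mcball unfolding c_def by blast
  have "\<exists>\<psi>. isometry (mcball b r) (mcball b' r) \<psi> \<and> \<psi> ` mball b r = mball b' r"
  proof (cases "d b' c < r")
    case True
    then have "mball b' r = mball c r" using b cM by (intro mball_recenter) auto
    then show ?thesis using \<phi> img by auto
  next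
    case False
    \<comment> \<open>As \<open>c\<close> lies in the closed ball but not in the open one, its
      distance to \<open>b'\<close> is exactly what the exchange requires.\<close>
    then have dist: "d c b' = r" using c commute [of c b'] by auto
    have "isometry (mball b r) (mball c r) \<phi>"
      using isometry_subset [OF \<phi> mball_subset_mcball] img by simp
    then have "isometry (mball c r) (mball b r) (inv_into (mball b r) \<phi>)"
      by (rule isometry_inv_into) auto
    \<comment> \<open>Go back from the ball about \<open>c\<close> to the one about \<open>b\<close>
      by the inverse of \<phi>, then on to the one about \<open>b'\<close> by \<theta>.\<close>
    then have \<chi>: "isometry (mball c r) (mball b' r) (\<theta> \<circ> inv_into (mball b r) \<phi>)"
      using \<theta> by (rule isometry_compose)
    obtain g where g: "isometry M M g"
      "\<And>x. x \<in> mball c r \<Longrightarrow> g x = (\<theta> \<circ> inv_into (mball b r) \<phi>) x"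
      using isometry_exchange [OF cM b(2) dist \<chi>] by metis
    have "g ` mball c r = (\<theta> \<circ> inv_into (mball b r) \<phi>) ` mball c r"
      by (rule image_cong [OF refl g(2)])
    then have gball: "g ` mball c r = mball b' r"
      using \<chi> unfolding isometry_def by simp
    moreover have "c \<in> mball c r" using cM r by auto
    ultimately have "g c \<in> mball b' r" by blast
    \<comment> \<open>One image in the closed ball is enough: \<open>g\<close> maps the closed ball
      about \<open>c\<close> onto the one about \<open>g c\<close>, and by recentring both equal
      \<open>mcball b' r\<close>.\<close>
    then have "g c \<in> mcball b' r" using mball_subset_mcball by blast
    then have "g ` mcball b' r = mcball b' r"
      using isometry_image_mcball [OF g(1) cM, of r] c_eq mcball_recenter by metis
    then have "isometry (mcball b' r) (mcball b' r) g"
      using isometry_subset [OF g(1) mcball_subset_mspace] by metis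
    then have "isometry (mcball b r) (mcball b' r) (g \<circ> \<phi>)"
      by (rule isometry_compose [OF \<phi>])
    moreover have "(g \<circ> \<phi>) ` mball b r = mball b' r"
      using img gball by (simp only: image_comp [symmetric])
    ultimately show ?thesis by blast
  qed
  then obtain \<psi> where \<psi>: "isometry (mcball b r) (mcball b' r) \<psi>"
    "\<psi> ` mball b r = mball b' r" by blast
  have sphere: "{x \<in> M. d a x = r} = mcball a r - mball a r" if "a \<in> M" for a
    using that by auto
  have "inj_on \<psi> (mcball b r)" using \<psi>(1) by (rule isometry_inj_on) auto
  then have "\<psi> ` (mcball b r - mball b r) = mcball b' r - mball b' r"
    using \<psi> mball_subset_mcball by (simp add: inj_on_image_set_diff isometry_def)
  then show ?thesis
    using isometry_subset [OF \<psi>(1) Diff_subset] b sphere by (metis isometric_def)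
qed

text \<open>The isometries of the spheres can be chosen independently for each radius: by the
  isosceles property, points on different spheres about \<open>b\<close> are at a distance equal to
  the larger radius.\<close>

lemma transitive_on_spectra:
  assumes hyp: "\<And>B B'. is_ball B \<Longrightarrow> is_ball B' \<Longrightarrow> similar B B' \<Longrightarrow> isometric B B'"
    and b: "b \<in> M" "b' \<in> M" "spectrum b = spectrum b'"
  obtains g where "isometry M M g" "g b = b'"
proof -
  let ?S = "\<lambda>a r. {x \<in> M. d a x = r}"
  obtain \<psi> where "\<And>r. isometry (?S b r) (?S b' r) (\<psi> r)"
    using sphere_isometry [OF hyp b] unfolding isometric_def by metis
  then have im: "\<psi> r ` ?S b r = ?S b' r"
    and iso: "\<And>x y. x \<in> ?S b r \<Longrightarrow> y \<in> ?S b r \<Longrightarrow> d (\<psi> r x) (\<psi> r y) = d x y" for r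
    unfolding isometry_def by blast+
  define g where "g x = \<psi> (d b x) x" for x
  have g: "g x \<in> M" "d b' (g x) = d b x" if "x \<in> M" for x
    using im [of "d b x"] that by (auto simp: g_def)
  have lt: "d (g x) (g y) = d x y" if "x \<in> M" "y \<in> M" "d b x < d b y" for x y
  proof -
    have "d x y = d b y"
      using dist_eq_of_less [of x b y] that b commute [of x b] by auto
    moreover have "d (g x) (g y) = d b' (g y)"
      using dist_eq_of_less [of "g x" b' "g y"] that b g commute [of "g x" b'] by auto
    ultimately show ?thesis using g that by simp
  qed
  have "d (g x) (g y) = d x y" if "x \<in> M" "y \<in> M" for x y
  proof (cases "d b x = d b y")
    case True
    then show ?thesis using iso [of x "d b x" y] that by (simp add: g_def)
  next
    case False
    then show ?thesis using lt [of x y] lt [of y x] that commute by (metis linorder_neqE)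
  qed
  moreover have "g ` M = M"
  proof
    show "g ` M \<subseteq> M" using g by auto
    show "M \<subseteq> g ` M"
    proof
      fix z assume "z \<in> M"
      then have "z \<in> \<psi> (d b' z) ` ?S b (d b' z)" using im by auto
      then obtain x where "x \<in> M" "d b x = d b' z" "z = \<psi> (d b' z) x" by blast
      then have "z = g x" by (simp only: g_def)
      then show "z \<in> g ` M" using \<open>x \<in> M\<close> by blast
    qed
  qed
  ultimately have "isometry M M g" by (simp add: isometry_def)
  moreover have "g b = b'" using g [of b] b by simp
  ultimately show thesis by (rule that)
qed

section \<open>Extending finite local spec-isometries\<close>

lemma transitive_on_spectra_fixing:
  assumes hyp: "\<And>B B'. is_ball B \<Longrightarrow> is_ball B' \<Longrightarrow> similar B B' \<Longrightarrow> isometric B B'"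
    and b: "b \<in> M" "b' \<in> M" "spectrum b = spectrum b'"
    and A: "A \<subseteq> M" "\<And>a. a \<in> A \<Longrightarrow> d a b = d a b'"
  obtains g where "isometry M M g" "g b = b'" "\<And>a. a \<in> A \<Longrightarrow> g a = a"
proof (cases "b = b'")
  case True
  show thesis by (rule that [of id]) (auto simp: True isometry_def)
next
  case False
  define s where "s = d b b'"
  \<comment> \<open>With \<open>s\<close> positive, \<open>b\<close> lies in its own open ball,
    where the exchange agrees with \<phi> and so sends it to \<open>b'\<close>.\<close>
  have s: "0 < s" using False b by (simp add: s_def)
  obtain \<phi> where \<phi>: "isometry M M \<phi>" "\<phi> b = b'"
    using transitive_on_spectra [OF hyp b] by blast
  have "\<phi> ` mball b s = mball b' s"
    using isometry_image_mball [OF \<phi>(1) b(1) order_refl order_refl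
      mball_subset_mspace mball_subset_mspace] unfolding \<phi>(2) .
  then have "isometry (mball b s) (mball b' s) \<phi>"
    using isometry_subset [OF \<phi>(1) mball_subset_mspace] by metis
  from isometry_exchange [OF b(1,2) s_def [symmetric] this] obtain g where
    g: "isometry M M g" "\<And>x. x \<in> mball b s \<Longrightarrow> g x = \<phi> x"
    "\<And>x. x \<in> M \<Longrightarrow> x \<notin> mball b s \<Longrightarrow> x \<notin> mball b' s \<Longrightarrow> g x = x" by metis
  have "g a = a" if "a \<in> A" for a
  proof -
    have "a \<in> M" using A that by auto
    \<comment> \<open>The triangle \<open>b\<close>, \<open>a\<close>, \<open>b'\<close> has two
      equal sides \<open>d a b\<close> and \<open>d a b'\<close>, and the third side
      \<open>s\<close> cannot exceed them.\<close>
    then have "s \<le> d a b"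
      using ultrametric [of b a b'] A(2) [OF that] b commute [of a b] by (simp add: s_def)
    then have "a \<notin> mball b s" "a \<notin> mball b' s"
      using A(2) [OF that] commute [of a b] commute [of a b'] by auto
    then show ?thesis using g(3) \<open>a \<in> M\<close> by blast
  qed
  moreover have "g b = b'" using g(2) [of b] s b \<phi>(2) by simp
  ultimately show thesis using that g(1) by blast
qed

lemma spec_homogeneous_if_isometric:
  assumes hyp: "\<And>B B'. is_ball B \<Longrightarrow> is_ball B' \<Longrightarrow> similar B B' \<Longrightarrow> isometric B B'"
  shows "spec_homogeneous"
proof -
  have "\<exists>g. isometry M M g \<and> (\<forall>x\<in>A. g x = f x)" if "finite A" "local_spec_isometry A f" for A f
    using that
  proof (induction A rule: finite_induct)
    case empty
    then show ?case by (auto simp: isometry_def intro: exI [of _ id])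
  next
    case (insert b A)
    have f: "insert b A \<subseteq> M" "f ` insert b A \<subseteq> M"
      "\<And>x y. x \<in> insert b A \<Longrightarrow> y \<in> insert b A \<Longrightarrow> d (f x) (f y) = d x y"
      "\<And>x. x \<in> insert b A \<Longrightarrow> spectrum x = spectrum (f x)"
      using insert.prems
      unfolding local_spec_isometry_def local_isometry_def isometry_def by blast+
    have "isometry A (f ` A) f" using f(3) by (simp add: isometry_def)
    moreover have "A \<subseteq> M" "f ` A \<subseteq> M" using f(1,2) by auto
    ultimately have "local_isometry A f" unfolding local_isometry_def by blast
    then have "local_spec_isometry A f" using f(4) by (simp add: local_spec_isometry_def)
    then obtain g where g: "isometry M M g" "\<And>x. x \<in> A \<Longrightarrow> g x = f x"
      using insert.IH by blast
    have "f b \<in> g ` M" using f(2) g(1) by (auto simp: isometry_def)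
    \<comment> \<open>Pulling \<open>f b\<close> back along \<open>g\<close> reduces the extension
      to moving \<open>b\<close> to \<open>b'\<close> while fixing \<open>A\<close>: since
      \<open>g\<close> preserves spectra and agrees with \<open>f\<close> on \<open>A\<close>, the
      points \<open>b\<close> and \<open>b'\<close> have equal spectra and equal distances to
      \<open>A\<close>.\<close>
    then obtain b' where b': "b' \<in> M" "g b' = f b" by auto
    have bM: "b \<in> M" and AM: "A \<subseteq> M" using f by auto
    have spec: "spectrum b = spectrum b'"
      using isometry_spectrum [OF g(1) b'(1)] f(4) [of b] b'(2) by simp
    have dist: "d a b = d a b'" if "a \<in> A" for a
    proof -
      have "d a b = d (f a) (f b)" using f(3) that by simp
      also have "\<dots> = d (g a) (g b')" using g(2) that b'(2) by simp
      also have "\<dots> = d a b'" using g(1) that AM b'(1) by (auto simp: isometry_def)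
      finally show ?thesis .
    qed
    obtain h where h: "isometry M M h" "h b = b'" "\<And>a. a \<in> A \<Longrightarrow> h a = a"
      using transitive_on_spectra_fixing [OF hyp bM b'(1) spec AM dist] by blast
    have "isometry M M (g \<circ> h)" using h(1) g(1) by (rule isometry_compose)
    moreover have "\<forall>x\<in>insert b A. (g \<circ> h) x = f x" using h g b' by auto
    ultimately show ?case by blast
  qed
  then show ?thesis by (auto simp: spec_homogeneous_def)
qed

end

theorem theorem9:
  fixes M :: "'a set" and d :: "'a \<Rightarrow> 'a \<Rightarrow> real"
  assumes "Ultrametric_space M d"
  shows "Metric_space.spec_homogeneous M d \<longleftrightarrow>
    (\<forall>B B'. Metric_space.is_ball M d B \<and> Metric_space.is_ball M d B' \<and>
        Metric_space.similar M d B B' \<longrightarrow> Metric_space.isometric d B B')"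
proof -
  interpret Ultrametric_space M d by (rule assms)
  show ?thesis
    using isometric_if_spec_homogeneous spec_homogeneous_if_isometric by blast
qed

end
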